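(* There is a universal constant $C>0$ such that the following holds. Let $N\ge2$ and let $f:\mathbb{Z}_N\to\mathbb{C}$ be an arbitrary nonzero function. For $p\in(0,1]$, let $X\subset\mathbb{Z}_N$ be formed by keeping each $x\in\mathbb{Z}_N$ independently with probability $p$, and define $f_X(x)=f(x)$ if $x\in X$ and $f_X(x)=0$ otherwise. Let $\mu(f)=N\|f\|_\infty^2/\|f\|_2^2$. Fix $\varepsilon\in(0,1)$ and $u\ge1$. If $$p\ge C\,\frac{\mu(f)}{\varepsilon^2}\,\frac uN,$$ then with probability at least $1-2e^{-u}$ we have $$\big|\|f_X\|_2-\sqrt p\,\|f\|_2\big|\le\varepsilon\sqrt p\,\|f\|_2 .$$ Equivalently, $$(1-\varepsilon)\sqrt p\,\|f\|_2\le\|f_X\|_2\le(1+\varepsilon)\sqrt p\,\|f\|_2 .$$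
   Context: $\mathbb{Z}_N=\mathbb{Z}/N\mathbb{Z}$. $\|g\|_2=\left(\sum_{x\in\mathbb{Z}_N}|g(x)|^2\right)^{1/2}$ and $\|g\|_\infty=\max_{x\in\mathbb{Z}_N}|g(x)|$. *)

theory Defs
  imports "HOL-Probability.Product_PMF" "HOL-Number_Theory.Residues"
begin

text \<open>
  A function on the integers modulo \<open>N\<close> is a function on \<open>int\<close> of which only the values on the
  carrier \<open>{0..int N - 1}\<close> of the residue ring matter.
\<close>

abbreviation ZN :: "nat \<Rightarrow> int set" where
  "ZN N \<equiv> carrier (residue_ring (int N))"

definition norm_2 :: "nat \<Rightarrow> (int \<Rightarrow> complex) \<Rightarrow> real" where
  "norm_2 N g = sqrt (\<Sum>x\<in>ZN N. (cmod (g x))\<^sup>2)"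

definition norm_sup :: "nat \<Rightarrow> (int \<Rightarrow> complex) \<Rightarrow> real" where
  "norm_sup N g = Max ((\<lambda>x. cmod (g x)) ` ZN N)"

definition mu :: "nat \<Rightarrow> (int \<Rightarrow> complex) \<Rightarrow> real" where
  "mu N f = real N * (norm_sup N f)\<^sup>2 / (norm_2 N f)\<^sup>2"

text \<open>
  The law of the random set obtained by keeping each \<open>x \<in> A\<close> independently with probability \<open>p\<close>,
  for finite \<open>A\<close> and \<open>0 \<le> p \<le> 1\<close>: the coordinates of \<open>Pi_pmf\<close> are independent, and
  \<open>False\<close> is merely its default value outside \<open>A\<close>.
\<close>

definition random_subset_pmf :: "'a set \<Rightarrow> real \<Rightarrow> 'a set pmf" where
  "random_subset_pmf A p =
     map_pmf (\<lambda>b. {x \<in> A. b x}) (Pi_pmf A False (\<lambda>_. bernoulli_pmf p))"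

definition restrict_zero :: "(int \<Rightarrow> complex) \<Rightarrow> int set \<Rightarrow> int \<Rightarrow> complex" where
  "restrict_zero f X x = (if x \<in> X then f x else 0)"

end

theory Submission
  imports Defs
begin

text \<open>
  With \<open>M = \<parallel>f\<parallel>\<^sub>\<infinity>\<close>, the weights \<open>a x = |f x|\<^sup>2 / M\<^sup>2\<close> lie in \<open>[0, 1]\<close> and have sum \<open>S = N / \<mu>(f)\<close>, so
  the hypothesis on \<open>p\<close> says \<open>p S \<epsilon>\<^sup>2 \<ge> C u\<close>. Since \<open>|\<surd>y - \<surd>z| \<le> |y - z| / \<surd>z\<close>, it is enough that the
  total weight of \<open>X\<close> is within \<open>\<epsilon> p S\<close> of its mean \<open>p S\<close>. The bound \<open>exp t \<le> 1 + t + t\<^sup>2\<close> for \<open>t \<le> 1\<close>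
  and the exponential Markov inequality with parameter \<open>\<epsilon> / 2\<close> bound each tail by
  \<open>exp (- \<epsilon>\<^sup>2 p S / 4)\<close>, whence \<open>C = 4\<close>.
\<close>

text \<open>For \<open>t \<ge> 0\<close> this is a known bound. For \<open>t = - y < 0\<close>,
  invert \<open>1 + y + y^2/2 \<le> exp y\<close>: its product with \<open>1 - y + y^2\<close> is at
  least 1. Negative \<open>t\<close> arises from the lower tail.\<close>

lemma exp_le_quadratic:
  fixes t :: real
  assumes "t \<le> 1"
  shows "exp t \<le> 1 + t + t\<^sup>2"
proof (cases "t \<ge> 0")
  case True
  then show ?thesis using exp_bound assms by blast
next
  case False
  define y where "y = - t"
  have y: "y > 0" using False by (simp add: y_def)
  \<comment> \<open>These terms are exactly the excess over 1 of the product in the next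
    line.\<close>
  have "0 \<le> y\<^sup>2 / 2 + y ^ 3 / 2 + y ^ 4 / 2" using y by simp
  also have "\<dots> = (1 - y + y\<^sup>2) * (1 + y + y\<^sup>2 / 2) - 1"
    by (simp add: field_simps power2_eq_square power3_eq_cube power4_eq_xxxx)
  finally have "1 \<le> (1 - y + y\<^sup>2) * (1 + y + y\<^sup>2 / 2)" by simp
  also have "\<dots> \<le> (1 - y + y\<^sup>2) * exp y"
  proof (rule mult_left_mono)
    show "1 + y + y\<^sup>2 / 2 \<le> exp y" using y by (intro exp_lower_Taylor_quadratic) simp
    have "0 \<le> (y - 1/2)\<^sup>2 + 3/4" by simp
    also have "\<dots> = 1 - y + y\<^sup>2" by (simp add: field_simps power2_eq_square)
    finally show "0 \<le> 1 - y + y\<^sup>2" .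
  qed
  finally have "exp (- y) \<le> 1 - y + y\<^sup>2"
    by (simp add: exp_minus field_simps)
  then show ?thesis by (simp add: y_def)
qed

text \<open>Factor \<open>y - z\<close> as a difference of squares and use
  \<open>sqrt y + sqrt z \<ge> sqrt z\<close>. This turns concentration of the squared norm into
  concentration of the norm.\<close>

lemma abs_sqrt_diff_le:
  assumes "0 \<le> y" "0 < z"
  shows "\<bar>sqrt y - sqrt z\<bar> \<le> \<bar>y - z\<bar> / sqrt z"
proof -
  have "\<bar>sqrt y - sqrt z\<bar> * sqrt z \<le> \<bar>sqrt y - sqrt z\<bar> * (sqrt y + sqrt z)"
    using assms by (intro mult_left_mono) auto
  also have "\<dots> = \<bar>(sqrt y - sqrt z) * (sqrt y + sqrt z)\<bar>"
    using assms by (simp add: abs_mult)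
  also have "(sqrt y - sqrt z) * (sqrt y + sqrt z) = y - z"
    using assms by (simp add: algebra_simps)
  finally show ?thesis using assms by (simp add: pos_le_divide_eq)
qed

lemma set_random_subset_pmf: "finite A \<Longrightarrow> set_pmf (random_subset_pmf A p) \<subseteq> Pow A"
  by (auto simp: random_subset_pmf_def)

text \<open>The exponential of the sum is a product of functions of independent coordinates, where
  an omitted point contributes the factor \<open>exp 0 = 1\<close>. Hence the expectation
  factorises.\<close>

lemma expectation_exp_random_subset_pmf:
  fixes w :: "'a \<Rightarrow> real"
  assumes "finite A" "0 \<le> p" "p \<le> 1"
  shows "measure_pmf.expectation (random_subset_pmf A p) (\<lambda>X. exp (\<Sum>x\<in>A \<inter> X. w x))
           = (\<Prod>x\<in>A. 1 + p * (exp (w x) - 1))"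
proof -
  have "exp (\<Sum>x\<in>A \<inter> {x \<in> A. b x}. w x) = (\<Prod>x\<in>A. if b x then exp (w x) else 1)" for b
  proof -
    have "(\<Sum>x\<in>A \<inter> {x \<in> A. b x}. w x) = (\<Sum>x\<in>A. if b x then w x else 0)"
      using assms by (intro sum.mono_neutral_cong_left) auto
    then show ?thesis using assms
      by (simp add: exp_sum if_distrib[of exp] cong: if_cong)
  qed
  then have "measure_pmf.expectation (random_subset_pmf A p) (\<lambda>X. exp (\<Sum>x\<in>A \<inter> X. w x))
      = measure_pmf.expectation (Pi_pmf A False (\<lambda>_. bernoulli_pmf p))
          (\<lambda>b. \<Prod>x\<in>A. if b x then exp (w x) else 1)"
    by (simp add: random_subset_pmf_def)
  also have "\<dots> = (\<Prod>x\<in>A. measure_pmf.expectation (bernoulli_pmf p) (\<lambda>v. if v then exp (w x) else 1))"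
    using assms(1)
    by (subst expectation_prod_Pi_pmf[where f = "\<lambda>x v. if v then exp (w x) else 1"])
       (auto intro: integrable_measure_pmf_finite)
  also have "\<dots> = (\<Prod>x\<in>A. 1 + p * (exp (w x) - 1))"
    using assms by (simp add: algebra_simps)
  finally show ?thesis .
qed

text \<open>Exponential Markov inequality with free parameter \<open>s\<close>. The weights may be
  signed, so that the lower tail follows by passing to \<open>- a\<close>.\<close>

lemma random_subset_pmf_upper_tail:
  fixes a :: "'a \<Rightarrow> real"
  assumes A: "finite A" and p: "0 \<le> p" "p \<le> 1" and s: "0 < s" "s \<le> 1"
    and a: "\<And>x. x \<in> A \<Longrightarrow> \<bar>a x\<bar> \<le> 1"
  shows "measure_pmf.prob (random_subset_pmf A p) {X. p * (\<Sum>x\<in>A. a x) + t \<le> (\<Sum>x\<in>A \<inter> X. a x)}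
           \<le> exp (s\<^sup>2 * p * (\<Sum>x\<in>A. \<bar>a x\<bar>) - s * t)"
proof -
  define m where "m = p * (\<Sum>x\<in>A. a x)"
  let ?R = "random_subset_pmf A p"
  have fin: "finite (set_pmf ?R)"
    using set_random_subset_pmf[OF A] A finite_subset by blast
  have factor: "1 + p * (exp (s * a x) - 1) \<le> exp (p * (s * a x) + s\<^sup>2 * p * \<bar>a x\<bar>)" if "x \<in> A" for x
  proof -
    have ax: "\<bar>a x\<bar> \<le> 1" using a that .
    have "s * a x \<le> s * 1" using s ax by (intro mult_left_mono) auto
    then have "s * a x \<le> 1" using s by linarith
    then have "exp (s * a x) - 1 \<le> s * a x + (s * a x)\<^sup>2" using exp_le_quadratic[of "s * a x"] by simp
    also have "(s * a x)\<^sup>2 = s\<^sup>2 * (\<bar>a x\<bar> * \<bar>a x\<bar>)"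
      by (simp add: power_mult_distrib power2_eq_square)
    \<comment> \<open>Since \<open>\<bar>a x\<bar> \<le> 1\<close>, the square is at most
      \<open>\<bar>a x\<bar>\<close>; the second-order term thus becomes linear in the total
      weight.\<close>
    also have "\<dots> \<le> s\<^sup>2 * \<bar>a x\<bar>"
      using ax by (intro mult_left_mono mult_left_le) auto
    finally have "p * (exp (s * a x) - 1) \<le> p * (s * a x + s\<^sup>2 * \<bar>a x\<bar>)"
      using p by (intro mult_left_mono) auto
    then have "1 + p * (exp (s * a x) - 1) \<le> 1 + (p * (s * a x) + s\<^sup>2 * p * \<bar>a x\<bar>)"
      by (simp add: algebra_simps)
    then show ?thesis using exp_ge_add_one_self order_trans by blast
  qed
  have "measure_pmf.prob ?R {X \<in> UNIV. m + t \<le> (\<Sum>x\<in>A \<inter> X. a x)}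
      \<le> exp (- s * (m + t)) * (\<integral>X\<in>UNIV. exp (s * (\<Sum>x\<in>A \<inter> X. a x)) \<partial>measure_pmf ?R)"
    using s fin by (intro measure_pmf.Chernoff_ineq_ge)
      (auto simp: set_integrable_def intro: integrable_measure_pmf_finite)
  also have "(\<integral>X\<in>UNIV. exp (s * (\<Sum>x\<in>A \<inter> X. a x)) \<partial>measure_pmf ?R)
      = (\<Prod>x\<in>A. 1 + p * (exp (s * a x) - 1))"
    using expectation_exp_random_subset_pmf[OF A p, of "\<lambda>x. s * a x"]
    by (simp add: set_lebesgue_integral_def sum_distrib_left)
  also have "\<dots> \<le> (\<Prod>x\<in>A. exp (p * (s * a x) + s\<^sup>2 * p * \<bar>a x\<bar>))"
  proof (rule prod_mono, intro conjI)
    fix x assume "x \<in> A"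
    \<comment> \<open>Comparing products factor by factor requires nonnegative factors; each is a
      convex combination of 1 and \<open>exp (s * a x)\<close>.\<close>
    show "0 \<le> 1 + p * (exp (s * a x) - 1)"
    proof -
      have "0 \<le> (1 - p) + p * exp (s * a x)" using p by simp
      then show ?thesis by (simp add: algebra_simps)
    qed
  qed (rule factor)
  also have "\<dots> = exp (s * m + s\<^sup>2 * p * (\<Sum>x\<in>A. \<bar>a x\<bar>))"
    using A by (simp add: exp_sum[symmetric] sum.distrib sum_distrib_left m_def mult_ac)
  finally show ?thesis
    by (simp add: m_def exp_add[symmetric] algebra_simps)
qed

text \<open>Each tail is bounded by \<open>exp (s^2 * m - s * \<epsilon> * m)\<close>, which
  \<open>s = \<epsilon> / 2\<close> minimises; \<open>\<epsilon> \<le> 2\<close> makes this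
  \<open>s\<close> admissible. The factor 2 is the union bound.\<close>

lemma random_subset_pmf_concentration:
  fixes a :: "'a \<Rightarrow> real"
  assumes A: "finite A" and p: "0 \<le> p" "p \<le> 1" and eps: "0 < \<epsilon>" "\<epsilon> \<le> 2"
    and a: "\<And>x. x \<in> A \<Longrightarrow> 0 \<le> a x" "\<And>x. x \<in> A \<Longrightarrow> a x \<le> 1"
  defines "m \<equiv> p * (\<Sum>x\<in>A. a x)"
  shows "measure_pmf.prob (random_subset_pmf A p) {X. \<bar>(\<Sum>x\<in>A \<inter> X. a x) - m\<bar> \<le> \<epsilon> * m}
           \<ge> 1 - 2 * exp (- (\<epsilon>\<^sup>2 * m / 4))"
proof -
  let ?P = "measure_pmf.prob (random_subset_pmf A p)"
  let ?Y = "\<lambda>X. \<Sum>x\<in>A \<inter> X. a x"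
  let ?U = "{X. m + \<epsilon> * m \<le> ?Y X}" and ?L = "{X. - m + \<epsilon> * m \<le> - ?Y X}"
  have abs_a: "(\<Sum>x\<in>A. \<bar>a x\<bar>) = (\<Sum>x\<in>A. a x)" using a by (intro sum.cong) auto
  have e: "(\<epsilon> / 2)\<^sup>2 * p * (\<Sum>x\<in>A. a x) - \<epsilon> / 2 * (\<epsilon> * m) = - (\<epsilon>\<^sup>2 * m / 4)"
    by (simp add: m_def power2_eq_square field_simps)
  have "?P ?U \<le> exp (- (\<epsilon>\<^sup>2 * m / 4))"
    using random_subset_pmf_upper_tail[OF A p, of "\<epsilon> / 2" a "\<epsilon> * m"] eps a abs_a e
    by (simp add: m_def)
  moreover have "?P ?L \<le> exp (- (\<epsilon>\<^sup>2 * m / 4))"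
    using random_subset_pmf_upper_tail[OF A p, of "\<epsilon> / 2" "\<lambda>x. - a x" "\<epsilon> * m"] eps a abs_a e
    by (simp add: m_def sum_negf)
  \<comment> \<open>A deviation exceeding \<open>\<epsilon> * m\<close> lies in one of the two
    closed tails, according to its sign.\<close>
  moreover have "?P (- {X. \<bar>?Y X - m\<bar> \<le> \<epsilon> * m}) \<le> ?P (?U \<union> ?L)"
    by (rule measure_pmf.finite_measure_mono) auto
  moreover have "?P (?U \<union> ?L) \<le> ?P ?U + ?P ?L"
    by (rule measure_Un_le) auto
  moreover have "?P (- {X. \<bar>?Y X - m\<bar> \<le> \<epsilon> * m}) = 1 - ?P {X. \<bar>?Y X - m\<bar> \<le> \<epsilon> * m}"
    using measure_pmf.prob_compl[of "{X. \<bar>?Y X - m\<bar> \<le> \<epsilon> * m}" "random_subset_pmf A p"]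
    by (simp add: Compl_eq_Diff_UNIV)
  ultimately show ?thesis by linarith
qed

lemma finite_ZN: "finite (ZN N)"
  by (simp add: residue_ring_def)

text \<open>Dividing the squared values by the squared sup norm gives weights in
  \<open>[0, 1]\<close>. The constant 4 cancels the denominator in the exponent
  \<open>\<epsilon>^2 * m / 4\<close>, so the hypothesis on \<open>p\<close> makes it at least
  \<open>u\<close>.\<close>

lemma prob_norm_2_restrict_zero:
  fixes f :: "int \<Rightarrow> complex"
  assumes N: "0 < N" and nz: "\<exists>x\<in>ZN N. f x \<noteq> 0" and p: "0 < p" "p \<le> 1"
    and eps: "0 < \<epsilon>" "\<epsilon> \<le> 2" and le: "p \<ge> 4 * (mu N f / \<epsilon>\<^sup>2) * (u / real N)"
  shows "measure_pmf.prob (random_subset_pmf (ZN N) p)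
      {X. \<bar>norm_2 N (restrict_zero f X) - sqrt p * norm_2 N f\<bar> \<le> \<epsilon> * sqrt p * norm_2 N f}
      \<ge> 1 - 2 * exp (- u)"
proof -
  define A where "A = ZN N"
  have A: "finite A" by (simp add: A_def finite_ZN)
  define M where "M = norm_sup N f"
  define S2 where "S2 = (\<Sum>x\<in>A. (cmod (f x))\<^sup>2)"
  define a where "a = (\<lambda>x. (cmod (f x))\<^sup>2 / M\<^sup>2)"
  define m where "m = p * (\<Sum>x\<in>A. a x)"
  have M_ge: "cmod (f x) \<le> M" if "x \<in> A" for x
    using that A unfolding M_def norm_sup_def A_def by (intro Max_ge) auto
  obtain x0 where x0: "x0 \<in> A" "f x0 \<noteq> 0" using nz by (auto simp: A_def)
  have M: "M > 0" using M_ge[OF x0(1)] x0(2) by (smt (verit) zero_less_norm_iff)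
  have S2: "S2 > 0" unfolding S2_def using x0 A by (intro sum_pos2[of _ x0]) auto
  have m_eq: "m = p * S2 / M\<^sup>2" by (simp add: m_def a_def S2_def sum_divide_distrib[symmetric])
  have n2: "norm_2 N f = sqrt S2" by (simp add: norm_2_def S2_def A_def)
  have "mu N f = real N * M\<^sup>2 / S2" using S2 by (simp add: mu_def n2 M_def)
  \<comment> \<open>The factor \<open>N\<close> in \<open>mu N f\<close> cancels against
    \<open>u / real N\<close>.\<close>
  then have "p \<ge> 4 * (M\<^sup>2 / S2 / \<epsilon>\<^sup>2) * u" using le N by (simp add: mult_ac)
  then have u: "u \<le> \<epsilon>\<^sup>2 * m / 4"
    using M S2 eps unfolding m_eq by (simp add: field_simps)
  have a: "0 \<le> a x" "x \<in> A \<Longrightarrow> a x \<le> 1" for x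
    using M M_ge[of x] by (auto simp: a_def divide_simps power_mono)
  \<comment> \<open>Deterministic part: concentration of the total weight implies that of the norm,
    with the same \<open>\<epsilon>\<close>.\<close>
  have sub: "\<bar>norm_2 N (restrict_zero f X) - sqrt p * norm_2 N f\<bar> \<le> \<epsilon> * sqrt p * norm_2 N f"
    if X: "\<bar>(\<Sum>x\<in>A \<inter> X. a x) - m\<bar> \<le> \<epsilon> * m" for X
  proof -
    define Y where "Y = (\<Sum>x\<in>A \<inter> X. (cmod (f x))\<^sup>2)"
    have "(\<Sum>x\<in>A. (cmod (restrict_zero f X x))\<^sup>2) = Y"
      unfolding Y_def using A by (intro sum.mono_neutral_cong_right) (auto simp: restrict_zero_def)
    then have nX: "norm_2 N (restrict_zero f X) = sqrt Y" by (simp add: norm_2_def A_def)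
    have "(\<Sum>x\<in>A \<inter> X. a x) = Y / M\<^sup>2" by (simp add: a_def Y_def sum_divide_distrib[symmetric])
    then have "\<bar>(Y - p * S2) / M\<^sup>2\<bar> \<le> \<epsilon> * (p * S2) / M\<^sup>2"
      using X by (simp add: m_eq diff_divide_distrib)
    then have Y: "\<bar>Y - p * S2\<bar> \<le> \<epsilon> * (p * S2)" using M by (simp add: divide_le_cancel)
    have "0 \<le> Y" by (simp add: Y_def sum_nonneg)
    then have "\<bar>sqrt Y - sqrt (p * S2)\<bar> \<le> \<bar>Y - p * S2\<bar> / sqrt (p * S2)"
      using p S2 by (intro abs_sqrt_diff_le) auto
    also have "\<dots> \<le> \<epsilon> * (p * S2) / sqrt (p * S2)"
      using Y p S2 by (intro divide_right_mono) auto
    also have "\<dots> = \<epsilon> * sqrt (p * S2)"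
      using p S2 by (metis real_div_sqrt less_imp_le mult_pos_pos times_divide_eq_right)
    finally show ?thesis by (simp add: nX n2 real_sqrt_mult)
  qed
  have "1 - 2 * exp (- u) \<le> 1 - 2 * exp (- (\<epsilon>\<^sup>2 * m / 4))" using u by simp
  also have "\<dots> \<le> measure_pmf.prob (random_subset_pmf A p) {X. \<bar>(\<Sum>x\<in>A \<inter> X. a x) - m\<bar> \<le> \<epsilon> * m}"
    unfolding m_def using A p eps a by (intro random_subset_pmf_concentration) auto
  also have "\<dots> \<le> measure_pmf.prob (random_subset_pmf A p)
      {X. \<bar>norm_2 N (restrict_zero f X) - sqrt p * norm_2 N f\<bar> \<le> \<epsilon> * sqrt p * norm_2 N f}"
    using sub by (intro measure_pmf.finite_measure_mono) auto
  finally show ?thesis by (simp add: A_def)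
qed

theorem theorem1p25:
  "\<exists>C::real. C > 0 \<and>
    (\<forall>(N::nat) (f::int \<Rightarrow> complex) (p::real) (\<epsilon>::real) (u::real).
       N \<ge> 2 \<longrightarrow> (\<exists>x\<in>ZN N. f x \<noteq> 0) \<longrightarrow> 0 < p \<longrightarrow> p \<le> 1 \<longrightarrow>
       0 < \<epsilon> \<longrightarrow> \<epsilon> < 1 \<longrightarrow> u \<ge> 1 \<longrightarrow>
       p \<ge> C * (mu N f / \<epsilon>\<^sup>2) * (u / real N) \<longrightarrow>
       measure_pmf.prob (random_subset_pmf (ZN N) p)
         {X. \<bar>norm_2 N (restrict_zero f X) - sqrt p * norm_2 N f\<bar> \<le> \<epsilon> * sqrt p * norm_2 N f}
         \<ge> 1 - 2 * exp (- u)
       \<and> (\<forall>X \<subseteq> ZN N.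
            \<bar>norm_2 N (restrict_zero f X) - sqrt p * norm_2 N f\<bar> \<le> \<epsilon> * sqrt p * norm_2 N f
            \<longleftrightarrow>
            (1 - \<epsilon>) * sqrt p * norm_2 N f \<le> norm_2 N (restrict_zero f X) \<and>
            norm_2 N (restrict_zero f X) \<le> (1 + \<epsilon>) * sqrt p * norm_2 N f))"
proof (intro exI[of _ 4] conjI allI impI)
  fix N f p \<epsilon> u
  assume "2 \<le> N" "\<exists>x\<in>ZN N. f x \<noteq> 0" "0 < p" "p \<le> 1" "0 < \<epsilon>" "\<epsilon> < 1"
    "p \<ge> 4 * (mu N f / \<epsilon>\<^sup>2) * (u / real N)"
  then show "measure_pmf.prob (random_subset_pmf (ZN N) p)
      {X. \<bar>norm_2 N (restrict_zero f X) - sqrt p * norm_2 N f\<bar> \<le> \<epsilon> * sqrt p * norm_2 N f}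
      \<ge> 1 - 2 * exp (- u)"
    by (intro prob_norm_2_restrict_zero) auto
\<comment> \<open>What remains is the positivity of 4 and the equivalence, which holds for each
  \<open>X\<close> by unfolding the absolute value.\<close>
qed (auto simp: abs_le_iff algebra_simps)

end
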